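(* Let $s$ be a positive integer. Suppose that $f$ and $g$ are two arithmetical functions with absolutely convergent Cohen-Ramanujan expansions $f(n)=\sum_{r=1}^{\infty}\widehat{f}(r)c_r^{s}(n)$ and $g(n)=\sum_{k=1}^{\infty}\widehat{g}(k)c_k^{s}(n)$ (for all positive integers $n$), with complex coefficients $\widehat{f}(r),\widehat{g}(k)$. Suppose that $$\sum_{r,k\ge 1}\vert \widehat{f}(r)\,\widehat{g}(k)\vert\,(r^s,k^s)_s\,\tau_s(r^s)\,\tau_s(k^s)<\infty .$$ Then as $N$ tends to infinity, $$\sum_{n\le N} f(n)g(n)\sim N\sum_{r=1}^{\infty}\widehat{f}(r)\widehat{g}(r)\Phi_s(r^s),$$ where the relation $\sim$ is understood as $\sum_{n\le N} f(n)g(n)= N\sum_{r}\widehat{f}(r)\widehat{g}(r)\Phi_s(r^s)+o(N)$.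
   Context: An arithmetical function is a complex-valued function on the positive integers. For a positive integer $s$ and integers $m,n$ not both zero, the generalized GCD $(m,n)_s$ is the largest $l^s$ (with $l$ a positive integer) dividing both $m$ and $n$. For positive integers $r,s$ and an integer $n$, the Cohen-Ramanujan sum is $c_r^s(n)=\sum_{1\le h\le r^s,\ (h,r^s)_s=1} e^{2\pi i n h/r^s}$. An arithmetical function $f$ has an (absolutely convergent) Cohen-Ramanujan expansion with coefficients $\widehat f(r)\in\mathbb{C}$ if for every positive integer $n$ the series $\sum_{r\ge1}\widehat f(r)c_r^s(n)$ converges (absolutely) to $f(n)$. $\tau_s(n)$ is the number of positive integers of the form $l^s$ ($l$ a positive integer) dividing $n$. Klee's function $\Phi_s(n)$ is the number of integers $m$ with $1\le m\le n$ and $(m,n)_s=1$. *)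

theory Defs
  imports "HOL-Analysis.Analysis" "HOL-Library.Landau_Symbols"
begin

(* The value is meaningful only for s > 0 and m, n not both zero: otherwise the set
   need not be finite and Max is unspecified. *)
definition gen_gcd :: "nat \<Rightarrow> int \<Rightarrow> int \<Rightarrow> nat" where
  "gen_gcd s m n = Max {l ^ s | l :: nat. l > 0 \<and> int (l ^ s) dvd m \<and> int (l ^ s) dvd n}"

definition cohen_ramanujan_sum :: "nat \<Rightarrow> nat \<Rightarrow> int \<Rightarrow> complex" where
  "cohen_ramanujan_sum s r n =
     (\<Sum>h | h \<in> {1..r ^ s} \<and> gen_gcd s (int h) (int (r ^ s)) = 1.
        exp (2 * of_real pi * \<i> * of_int n * of_nat h / of_nat (r ^ s)))"

(* Arithmetical functions and coefficient families are functions on nat whose value at 0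
   is never used; a series over r >= 1 is therefore written with the index Suc r. *)
definition has_abs_cohen_ramanujan_expansion ::
    "nat \<Rightarrow> (nat \<Rightarrow> complex) \<Rightarrow> (nat \<Rightarrow> complex) \<Rightarrow> bool" where
  "has_abs_cohen_ramanujan_expansion s f fh \<longleftrightarrow>
     (\<forall>n::nat. n > 0 \<longrightarrow>
        summable (\<lambda>r. norm (fh (Suc r) * cohen_ramanujan_sum s (Suc r) (int n))) \<and>
        (\<lambda>r. fh (Suc r) * cohen_ramanujan_sum s (Suc r) (int n)) sums f n)"

definition tau :: "nat \<Rightarrow> nat \<Rightarrow> nat" where
  "tau s n = card {l ^ s | l :: nat. l > 0 \<and> l ^ s dvd n}"

definition klee_phi :: "nat \<Rightarrow> nat \<Rightarrow> nat" where
  "klee_phi s n = card {m \<in> {1..n}. gen_gcd s (int m) (int n) = 1}"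

end

(* Inclusion-exclusion over the primes dividing r gives |c_r(n)| <= sum of d^s over d | r with
   d^s | n, without the Moebius function. Counting common multiples of d^s and e^s, this bounds
   the mean of |c_r c_k| over n <= N by (r^s,k^s)_s tau_s(r^s) tau_s(k^s), uniformly in N.
   Writing c_r c_k = c_r cnj(c_k) as a sum of n-th powers of roots of unity, the mean of c_r c_k
   tends to the number of pairs (h,j) with h/r^s = j/k^s, which is Phi_s(r^s) if r = k and 0
   otherwise. Dominated convergence over the pairs (r,k) finishes the proof. *)
theory Submission
  imports Defs "HOL-Computational_Algebra.Primes"
begin

section \<open>Generalized gcds and divisor counts of s-th powers\<close>

lemma gen_gcd_eq_1_iff:
  fixes m n :: nat
  assumes "s > 0" "n > 0"
  shows "gen_gcd s (int m) (int n) = 1 \<longleftrightarrow> (\<forall>l>0. l ^ s dvd m \<longrightarrow> l ^ s dvd n \<longrightarrow> l = 1)"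
proof -
  define L where "L = {l ^ s | l :: nat. l > 0 \<and> int (l ^ s) dvd int m \<and> int (l ^ s) dvd int n}"
  \<comment> \<open>Positivity of \<open>n\<close> bounds the set, so \<open>Max\<close> has its
    intended meaning even when \<open>m = 0\<close>.\<close>
  have "L \<subseteq> {..n}"
    using assms by (auto simp: L_def simp flip: of_nat_power dest!: dvd_imp_le)
  then have fin: "finite L"
    by (rule finite_subset) simp
  have "1 \<in> L"
    unfolding L_def by (intro CollectI exI[of _ 1]) simp
  have "Max L = 1 \<longleftrightarrow> (\<forall>x\<in>L. x \<le> 1)"
    using \<open>1 \<in> L\<close> fin by (auto intro!: Max_eqI dest: Max_ge)
  also have "\<dots> \<longleftrightarrow> (\<forall>l>0. l ^ s dvd m \<longrightarrow> l ^ s dvd n \<longrightarrow> l ^ s \<le> 1)"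
    unfolding L_def by (auto simp flip: of_nat_power)
  also have "\<dots> \<longleftrightarrow> (\<forall>l>0. l ^ s dvd m \<longrightarrow> l ^ s dvd n \<longrightarrow> l = 1)"
    using assms(1) by (auto simp: power_le_one_iff le_Suc_eq)
  finally show ?thesis
    by (simp add: gen_gcd_def L_def)
qed

text \<open>Since \<open>l ^ s dvd r ^ s\<close> means \<open>l dvd r\<close>, and any
  \<open>l\<close> other than 1 has a prime factor, it suffices to test primes dividing
  \<open>r\<close>. This finite list of conditions is what inclusion-exclusion expands
  later.\<close>

lemma gen_gcd_power_eq_1_iff:
  fixes h r :: nat
  assumes "s > 0" "r > 0"
  shows "gen_gcd s (int h) (int (r ^ s)) = 1 \<longleftrightarrow> (\<forall>p\<in>prime_factors r. \<not> p ^ s dvd h)"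
proof -
  have "gen_gcd s (int h) (int (r ^ s)) = 1 \<longleftrightarrow> (\<forall>l>0. l ^ s dvd h \<longrightarrow> l dvd r \<longrightarrow> l = 1)"
    using assms by (subst gen_gcd_eq_1_iff) auto
  also have "\<dots> \<longleftrightarrow> (\<forall>p\<in>prime_factors r. \<not> p ^ s dvd h)"
  proof (intro iffI ballI allI impI)
    fix p assume "\<forall>l>0. l ^ s dvd h \<longrightarrow> l dvd r \<longrightarrow> l = 1" "p \<in> prime_factors r"
    moreover from this have "p > 0" "p \<noteq> 1" "p dvd r"
      by (auto simp: in_prime_factors_iff prime_gt_0_nat)
    ultimately show "\<not> p ^ s dvd h"
      by blast
  next
    fix l assume l: "\<forall>p\<in>prime_factors r. \<not> p ^ s dvd h" "l ^ s dvd h" "l dvd r"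
    show "l = 1"
    proof (rule ccontr)
      assume "l \<noteq> 1"
      then obtain p where "prime p" "p dvd l"
        using prime_factor_nat by blast
      then have "p \<in> prime_factors r" "p ^ s dvd h"
        using l assms(2) by (auto simp: in_prime_factors_iff intro: dvd_trans dvd_power_same)
      with l(1) show False by blast
    qed
  qed
  finally show ?thesis .
qed

text \<open>The common s-th power divisors are exactly the s-th powers of divisors of
  \<open>gcd r k\<close>. This turns the weight in the summability hypothesis into an ordinary
  gcd.\<close>

lemma gen_gcd_power_power:
  fixes r k :: nat
  assumes "s > 0" "r > 0"
  shows "gen_gcd s (int (r ^ s)) (int (k ^ s)) = gcd r k ^ s"
proof -
  have eq: "{l ^ s | l :: nat. l > 0 \<and> int (l ^ s) dvd int (r ^ s) \<and> int (l ^ s) dvd int (k ^ s)}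
      = (\<lambda>l. l ^ s) ` {l. l dvd gcd r k}"
    using assms by (auto simp del: of_nat_power intro!: Nat.gr0I)
  show ?thesis
    unfolding gen_gcd_def eq
  proof (rule Max_eqI)
    show "finite ((\<lambda>l. l ^ s) ` {l. l dvd gcd r k})"
      using assms by simp
    show "y \<le> gcd r k ^ s" if "y \<in> (\<lambda>l. l ^ s) ` {l. l dvd gcd r k}" for y
      using that assms by (auto intro!: power_mono dvd_imp_le simp del: gcd_greatest_iff)
  qed simp
qed

lemma tau_power:
  assumes "s > 0" "r > 0"
  shows "tau s (r ^ s) = card {d. d dvd r}"
proof -
  have eq: "{l ^ s | l :: nat. l > 0 \<and> l ^ s dvd r ^ s} = (\<lambda>l. l ^ s) ` {d. d dvd r}"
    using assms by (auto intro!: Nat.gr0I)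
  show ?thesis
    unfolding tau_def eq using assms
    by (intro card_image inj_onI) (auto intro: power_eq_imp_eq_base)
qed

text \<open>Powers of distinct primes are coprime, so dividing \<open>h\<close> separately and
  jointly is the same.\<close>

lemma prod_primes_power_dvd_iff:
  fixes h s :: nat
  assumes "finite P" "\<And>p. p \<in> P \<Longrightarrow> prime p"
  shows "\<Prod>P ^ s dvd h \<longleftrightarrow> (\<forall>p\<in>P. p ^ s dvd h)"
  using assms
proof (induction P)
  case (insert p P)
  have "coprime p (\<Prod>P)"
    using insert.hyps insert.prems by (intro prod_coprime_right) (auto intro: primes_coprime)
  then have "coprime (p ^ s) (\<Prod>P ^ s)"
    by simp
  then have "(p * \<Prod>P) ^ s dvd h \<longleftrightarrow> p ^ s dvd h \<and> \<Prod>P ^ s dvd h"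
    unfolding power_mult_distrib by (auto intro: divides_mult dvd_mult_left dvd_mult_right)
  then show ?case
    using insert by simp
qed simp

lemma prod_prime_factors_dvd:
  fixes r :: nat
  assumes "S \<subseteq> prime_factors r"
  shows "\<Prod>S dvd r"
proof -
  \<comment> \<open>Exponent 1 turns the criterion for s-th powers into plain divisibility.\<close>
  have "\<Prod>S ^ 1 dvd r \<longleftrightarrow> (\<forall>p\<in>S. p ^ 1 dvd r)"
    using assms finite_subset[OF assms] by (intro prod_primes_power_dvd_iff) auto
  then show ?thesis
    using assms by auto
qed

lemma div_dvd_self:
  fixes d r :: nat
  assumes "d dvd r"
  shows "r div d dvd r"
  by (rule dvdI[of _ _ d]) (use assms in simp)

section \<open>Sums of roots of unity\<close>

lemma cis_eq_1_iff_dvd: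
  assumes "m > 0"
  shows "cis (2 * pi * real n / real m) = 1 \<longleftrightarrow> m dvd n"
proof -
  have "cis (2 * pi * real n / real m) = 1 \<longleftrightarrow> (\<exists>i::int. 2 * pi * real n / real m = 2 * pi * of_int i)"
    by (subst cis_conv_exp, subst exp_eq_1) (auto simp: algebra_simps)
  also have "\<dots> \<longleftrightarrow> (\<exists>i::int. real n = real m * of_int i)"
    using assms by (auto simp: field_simps)
  also have "\<dots> \<longleftrightarrow> (\<exists>i::int. int n = int m * i)"
    by (metis of_int_eq_iff of_int_mult of_int_of_nat_eq)
  also have "\<dots> \<longleftrightarrow> m dvd n"
    by (simp flip: dvd_def)
  finally show ?thesis .
qed

lemma sum_powers_root_of_unity:
  fixes w :: complex
  assumes "w ^ m = 1"
  shows "(\<Sum>j = 1..m. w ^ j) = (if w = 1 then of_nat m else 0)"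
proof (cases "w = 1")
  case False
  have "(\<Sum>j = 1..m. w ^ j) = w * (\<Sum>j<m. w ^ j)"
    by (simp add: sum_distrib_left sum.atLeast1_atMost_eq)
  also have "(\<Sum>j<m. w ^ j) = 0"
    using False assms by (simp add: geometric_sum)
  finally show ?thesis
    using False by simp
qed simp

text \<open>Substituting \<open>h = D * j\<close> cancels \<open>D\<close> and leaves a full sum of
  powers of the m-th root of unity \<open>cis (2 * pi * n / m)\<close>, which equals 1 exactly when
  \<open>m dvd n\<close>.\<close>

lemma sum_cis_multiples:
  fixes D m n :: nat
  assumes "D > 0" "m > 0"
  shows "(\<Sum>h | h \<in> {1..D * m} \<and> D dvd h. cis (2 * pi * real n * real h / real (D * m)))
         = (if m dvd n then of_nat m else 0)"
proof -
  have "(\<Sum>h | h \<in> {1..D * m} \<and> D dvd h. cis (2 * pi * real n * real h / real (D * m)))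
      = (\<Sum>j = 1..m. cis (2 * pi * real n / real m) ^ j)"
    using assms
    by (intro sum.reindex_bij_witness[of _ "\<lambda>j. D * j" "\<lambda>h. h div D"])
       (auto simp: Complex.DeMoivre mult_ac elim!: dvdE)
  also have "\<dots> = (if m dvd n then of_nat m else 0)"
    using assms by (subst sum_powers_root_of_unity) (auto simp: cis_eq_1_iff_dvd Complex.DeMoivre)
  finally show ?thesis .
qed

section \<open>Inclusion-exclusion formula for Cohen-Ramanujan sums\<close>

lemma cohen_ramanujan_sum_cis:
  "cohen_ramanujan_sum s r (int n) =
     (\<Sum>h | h \<in> {1..r ^ s} \<and> gen_gcd s (int h) (int (r ^ s)) = 1.
        cis (2 * pi * real n * real h / real (r ^ s)))"
  unfolding cohen_ramanujan_sum_def cis_conv_exp by (intro sum.cong refl arg_cong[of _ _ exp]) simp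

text \<open>The classical form is the sum of mu(r/d) d^s over d dividing r with d^s dividing n. Only
  squarefree r/d contribute; these are the products over sets \<open>S\<close> of primes dividing
  \<open>r\<close>, with sign \<open>(-1) ^ card S\<close>.\<close>

lemma cohen_ramanujan_sum_formula:
  assumes "s > 0" "r > 0"
  shows "cohen_ramanujan_sum s r (int n) =
    (\<Sum>S\<in>Pow (prime_factors r). (-1) ^ card S *
       (if (r div \<Prod>S) ^ s dvd n then of_nat ((r div \<Prod>S) ^ s) else 0))"
proof -
  define e where "e h = cis (2 * pi * real n * real h / real (r ^ s))" for h
  define P where "P = prime_factors r"
  have P: "finite P" "\<And>p. p \<in> P \<Longrightarrow> prime p"
    by (auto simp: P_def)
  have prod_dvd: "\<Prod>S dvd r" if "S \<subseteq> P" for S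
    using that unfolding P_def by (rule prod_prime_factors_dvd)
  have "cohen_ramanujan_sum s r (int n) = (\<Sum>h\<in>{1..r ^ s}. if \<forall>p\<in>P. \<not> p ^ s dvd h then e h else 0)"
    unfolding cohen_ramanujan_sum_cis gen_gcd_power_eq_1_iff[OF assms] e_def P_def
    by (rule sum.inter_filter) simp
  also have "\<dots> = (\<Sum>h\<in>{1..r ^ s}. \<Sum>S\<in>Pow P. if \<Prod>S ^ s dvd h then (-1) ^ card S * e h else 0)"
  proof (rule sum.cong)
    fix h
    \<comment> \<open>A factor vanishes exactly when \<open>p ^ s dvd h\<close>, so the product is
      the indicator of the gcd condition. Multiplying it out gives the sum over subsets.\<close>
    have "(\<Prod>p\<in>P. 1 - (if p ^ s dvd h then 1 else 0 :: complex)) = (if \<forall>p\<in>P. \<not> p ^ s dvd h then 1 else 0)"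
      using P(1) by auto
    then have "(if \<forall>p\<in>P. \<not> p ^ s dvd h then e h else 0)
        = (\<Prod>p\<in>P. 1 - (if p ^ s dvd h then 1 else 0 :: complex)) * e h"
      by auto
    also have "\<dots> = (\<Sum>S\<in>Pow P. (-1) ^ card S * (\<Prod>p\<in>S. if p ^ s dvd h then 1 else 0) * e h)"
      using P(1) by (simp add: prod_diff_conv_sum sum_distrib_right)
    also have "\<dots> = (\<Sum>S\<in>Pow P. if \<Prod>S ^ s dvd h then (-1) ^ card S * e h else 0)"
    proof (rule sum.cong)
      fix S assume "S \<in> Pow P"
      then have "finite S" "\<And>p. p \<in> S \<Longrightarrow> prime p"
        using P finite_subset by auto
      moreover from \<open>finite S\<close> have "(\<Prod>p\<in>S. if p ^ s dvd h then 1 else 0 :: complex) = (if \<forall>p\<in>S. p ^ s dvd h then 1 else 0)"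
        by auto
      ultimately show "(-1) ^ card S * (\<Prod>p\<in>S. if p ^ s dvd h then 1 else 0) * e h
          = (if \<Prod>S ^ s dvd h then (-1) ^ card S * e h else 0)"
        by (simp add: prod_primes_power_dvd_iff)
    qed simp
    finally show "(if \<forall>p\<in>P. \<not> p ^ s dvd h then e h else 0)
        = (\<Sum>S\<in>Pow P. if \<Prod>S ^ s dvd h then (-1) ^ card S * e h else 0)" .
  qed simp
  also have "\<dots> = (\<Sum>S\<in>Pow P. \<Sum>h\<in>{1..r ^ s}. if \<Prod>S ^ s dvd h then (-1) ^ card S * e h else 0)"
    by (rule sum.swap)
  also have "\<dots> = (\<Sum>S\<in>Pow P. (-1) ^ card S * (\<Sum>h | h \<in> {1..r ^ s} \<and> \<Prod>S ^ s dvd h. e h))"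
    unfolding sum_distrib_left by (intro sum.cong refl sum.inter_filter[symmetric]) simp
  also have "\<dots> = (\<Sum>S\<in>Pow P. (-1) ^ card S *
       (if (r div \<Prod>S) ^ s dvd n then of_nat ((r div \<Prod>S) ^ s) else 0))"
  proof (intro sum.cong refl arg_cong2[of _ _ _ _ "(*)"])
    fix S assume "S \<in> Pow P"
    then have "\<Prod>S dvd r"
      using prod_dvd by simp
    then have r: "r = \<Prod>S * (r div \<Prod>S)"
      by simp
    then have pos: "\<Prod>S > 0" "r div \<Prod>S > 0"
      using assms(2) by (auto intro!: Nat.gr0I simp del: prod_zero_iff)
    \<comment> \<open>This factorization fits \<open>sum_cis_multiples\<close> with
      \<open>D = \<Prod>S ^ s\<close> and \<open>m = (r div \<Prod>S) ^ s\<close>.\<close>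
    have rs: "r ^ s = \<Prod>S ^ s * (r div \<Prod>S) ^ s"
      unfolding power_mult_distrib[symmetric] using r by simp
    show "(\<Sum>h | h \<in> {1..r ^ s} \<and> \<Prod>S ^ s dvd h. e h)
        = (if (r div \<Prod>S) ^ s dvd n then of_nat ((r div \<Prod>S) ^ s) else 0)"
      unfolding e_def rs using pos by (intro sum_cis_multiples) auto
  qed
  finally show ?thesis
    by (simp add: P_def)
qed

text \<open>By the triangle inequality the signs disappear. Distinct \<open>S\<close> give distinct
  divisors \<open>r div \<Prod>S\<close>, so the result is part of a nonnegative sum over all
  divisors.\<close>

lemma norm_cohen_ramanujan_sum_le:
  assumes "s > 0" "r > 0"
  shows "norm (cohen_ramanujan_sum s r (int n)) \<le> (\<Sum>d | d dvd r. if d ^ s dvd n then real (d ^ s) else 0)"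
proof -
  define P where "P = prime_factors r"
  have P: "finite P" "\<And>p. p \<in> P \<Longrightarrow> prime p"
    by (auto simp: P_def)
  have prod_dvd: "\<Prod>S dvd r" if "S \<subseteq> P" for S
    using that unfolding P_def by (rule prod_prime_factors_dvd)
  \<comment> \<open>The quotient determines \<open>\<Prod>S\<close>, and unique factorization
    recovers \<open>S\<close> as its set of prime factors.\<close>
  have inj: "inj_on (\<lambda>S. r div \<Prod>S) (Pow P)"
  proof (rule inj_onI)
    fix S T assume ST: "S \<in> Pow P" "T \<in> Pow P" "r div \<Prod>S = r div \<Prod>T"
    then have "\<Prod>S * (r div \<Prod>S) = r" "\<Prod>T * (r div \<Prod>S) = r"
      using prod_dvd[of S] prod_dvd[of T] by (metis PowD dvd_mult_div_cancel)+
    then have "\<Prod>S = \<Prod>T"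
      using assms(2) by (metis mult_cancel2 mult_0_right less_numeral_extra(3))
    moreover have "prime_factors (\<Prod>S) = S" if "S \<subseteq> P" for S
    proof -
      have S: "finite S" "\<And>p. p \<in> S \<Longrightarrow> prime p"
        using that P finite_subset by auto
      then have "prime_factors (\<Prod>S) = (\<Union>p\<in>S. prime_factors p)"
        by (subst prime_factors_prod) (use not_prime_0 in \<open>auto simp del: not_prime_0\<close>)
      also have "\<dots> = S"
        using S(2) by (auto simp: prime_prime_factors)
      finally show ?thesis .
    qed
    ultimately show "S = T"
      using ST by (metis PowD)
  qed
  have "norm (cohen_ramanujan_sum s r (int n)) \<le> (\<Sum>S\<in>Pow P. norm ((-1) ^ card S *
       (if (r div \<Prod>S) ^ s dvd n then of_nat ((r div \<Prod>S) ^ s) else 0 :: complex)))"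
    unfolding cohen_ramanujan_sum_formula[OF assms] P_def by (rule norm_sum)
  also have "\<dots> = (\<Sum>S\<in>Pow P. if (r div \<Prod>S) ^ s dvd n then real ((r div \<Prod>S) ^ s) else 0)"
    by (intro sum.cong) (auto simp: norm_mult norm_power)
  also have "\<dots> = (\<Sum>d\<in>(\<lambda>S. r div \<Prod>S) ` Pow P. if d ^ s dvd n then real (d ^ s) else 0)"
    by (simp add: sum.reindex[OF inj])
  also have "\<dots> \<le> (\<Sum>d | d dvd r. if d ^ s dvd n then real (d ^ s) else 0)"
    using assms(2) prod_dvd by (intro sum_mono2) (auto intro: div_dvd_self)
  finally show ?thesis .
qed

text \<open>Every term of the inclusion-exclusion formula is real.\<close>

lemma cnj_cohen_ramanujan_sum:
  assumes "s > 0" "r > 0"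
  shows "cnj (cohen_ramanujan_sum s r (int n)) = cohen_ramanujan_sum s r (int n)"
  unfolding cohen_ramanujan_sum_formula[OF assms] by (auto intro!: sum.cong simp: cnj_sum)

section \<open>Uniform bound for the means of products\<close>

lemma card_multiples_le: "real (card {n\<in>{1..N}. m dvd n}) \<le> real N / real m"
proof (cases "m > 0")
  case True
  have "{n\<in>{1..N}. m dvd n} \<subseteq> (\<lambda>j. m * j) ` {1..N div m}"
  proof
    fix n assume "n \<in> {n\<in>{1..N}. m dvd n}"
    with True show "n \<in> (\<lambda>j. m * j) ` {1..N div m}"
      by (intro image_eqI[of _ _ "n div m"]) (auto simp: div_le_mono elim!: dvdE)
  qed
  then have "card {n\<in>{1..N}. m dvd n} \<le> card ((\<lambda>j. m * j) ` {1..N div m})"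
    by (intro card_mono) auto
  also have "\<dots> \<le> N div m"
    using card_image_le[of "{1..N div m}" "\<lambda>j. m * j"] by simp
  finally have "real (card {n\<in>{1..N}. m dvd n}) \<le> real (N div m)"
    by simp
  also have "\<dots> \<le> real N / real m"
    by (rule of_nat_div_le_of_nat)
  finally show ?thesis .
next
  \<comment> \<open>For \<open>m = 0\<close> no positive integer is a multiple, and division by zero
    gives 0 on the right.\<close>
  case False
  then have "{n\<in>{1..N}. m dvd n} = {}"
    by auto
  then show ?thesis
    by (simp only: card.empty) simp
qed

text \<open>After both divisor bounds are multiplied out, a pair (d, e) contributes d^s e^s for each
  n up to \<open>N\<close> divisible by both d^s and e^s. Each pair costs at most \<open>N\<close>
  times \<open>gcd r k ^ s\<close>, and the divisor counts give the number of pairs.\<close>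

lemma sum_norm_cohen_ramanujan_sum_le:
  assumes "s > 0" "r > 0" "k > 0"
  shows "(\<Sum>n = 1..N. norm (cohen_ramanujan_sum s r (int n) * cohen_ramanujan_sum s k (int n)))
    \<le> real N * (real (gcd r k ^ s) * real (card {d. d dvd r}) * real (card {d. d dvd k}))"
proof -
  define w where "w d n = (if d ^ s dvd n then real (d ^ s) else 0)" for d n
  have w_le: "(\<Sum>n = 1..N. w d n * w e n) \<le> real N * real (gcd r k ^ s)" if "d dvd r" "e dvd k" for d e
  proof -
    have pos: "d > 0" "e > 0"
      using that assms by (metis dvd_0_left_iff neq0_conv)+
    have "(\<Sum>n = 1..N. w d n * w e n) = (\<Sum>n = 1..N. if lcm (d ^ s) (e ^ s) dvd n then real (d ^ s * e ^ s) else 0)"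
      by (intro sum.cong) (auto simp: w_def)
    also have "\<dots> = real (card {n\<in>{1..N}. lcm (d ^ s) (e ^ s) dvd n}) * real (d ^ s * e ^ s)"
      by (subst sum.inter_filter[symmetric]) auto
    also have "\<dots> \<le> real N / real (lcm (d ^ s) (e ^ s)) * real (d ^ s * e ^ s)"
      by (intro mult_right_mono card_multiples_le) simp
    \<comment> \<open>The lcm cancels against the density of common multiples, so only the gcd
      survives.\<close>
    also have "real (d ^ s * e ^ s) = real (lcm (d ^ s) (e ^ s)) * real (gcd (d ^ s) (e ^ s))"
      by (metis of_nat_mult mult.commute prod_gcd_lcm_nat)
    also have "real N / real (lcm (d ^ s) (e ^ s)) * (real (lcm (d ^ s) (e ^ s)) * real (gcd (d ^ s) (e ^ s)))
        = real N * real (gcd d e ^ s)"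
      using pos by simp
    also have "\<dots> \<le> real N * real (gcd r k ^ s)"
      using that assms by (intro mult_left_mono of_nat_mono power_mono dvd_imp_le gcd_mono) auto
    finally show ?thesis .
  qed
  have "(\<Sum>n = 1..N. norm (cohen_ramanujan_sum s r (int n) * cohen_ramanujan_sum s k (int n)))
      \<le> (\<Sum>n = 1..N. (\<Sum>d | d dvd r. w d n) * (\<Sum>e | e dvd k. w e n))"
    unfolding norm_mult w_def using assms
    by (intro sum_mono mult_mono norm_cohen_ramanujan_sum_le sum_nonneg) auto
  also have "\<dots> = (\<Sum>n = 1..N. \<Sum>d | d dvd r. \<Sum>e | e dvd k. w d n * w e n)"
    by (simp add: sum_product)
  also have "\<dots> = (\<Sum>d | d dvd r. \<Sum>n = 1..N. \<Sum>e | e dvd k. w d n * w e n)"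
    by (rule sum.swap)
  also have "\<dots> = (\<Sum>d | d dvd r. \<Sum>e | e dvd k. \<Sum>n = 1..N. w d n * w e n)"
    by (intro sum.cong refl sum.swap)
  also have "\<dots> \<le> (\<Sum>d | d dvd r. \<Sum>e | e dvd k. real N * real (gcd r k ^ s))"
    by (intro sum_mono w_le) auto
  also have "\<dots> = real N * (real (gcd r k ^ s) * real (card {d. d dvd r}) * real (card {d. d dvd k}))"
    by simp
  finally show ?thesis .
qed

section \<open>Limits of the means of products\<close>

lemma tendsto_mean_powers:
  fixes z :: complex
  assumes "norm z = 1"
  shows "(\<lambda>N. (\<Sum>n = 1..N. z ^ n) / of_nat N) \<longlonglongrightarrow> (if z = 1 then 1 else 0)"
proof (cases "z = 1")
  case True
  have "(\<lambda>N. 1 :: complex) \<longlonglongrightarrow> 1"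
    by simp
  moreover have "\<forall>\<^sub>F N in sequentially. 1 = (\<Sum>n = 1..N. z ^ n) / of_nat N"
    \<comment> \<open>At \<open>N = 0\<close> the quotient is 0 by convention, hence the restriction
      to positive \<open>N\<close>.\<close>
    using eventually_gt_at_top[of 0] by eventually_elim (simp add: True)
  ultimately show ?thesis
    using True by (simp add: tendsto_cong)
next
  case False
  \<comment> \<open>For \<open>z\<close> other than 1 the geometric sum stays bounded independently
    of \<open>N\<close>, because \<open>z ^ N\<close> remains on the unit circle; dividing by
    \<open>N\<close> sends it to 0.\<close>
  have "norm (\<Sum>n = 1..N. z ^ n) \<le> 2 / norm (z - 1)" for N
  proof -
    have "(\<Sum>n = 1..N. z ^ n) = z * (\<Sum>n<N. z ^ n)"
      by (simp add: sum_distrib_left sum.atLeast1_atMost_eq)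
    also have "\<dots> = z * ((z ^ N - 1) / (z - 1))"
      using False by (simp add: geometric_sum)
    also have "norm \<dots> = norm (z ^ N - 1) / norm (z - 1)"
      using assms by (simp add: norm_mult norm_divide)
    also have "norm (z ^ N - 1) \<le> 2"
      using norm_triangle_ineq4[of "z ^ N" 1] assms by (simp add: norm_power)
    finally show ?thesis
      by (simp add: divide_right_mono)
  qed
  then have "norm ((\<Sum>n = 1..N. z ^ n) / of_nat N) \<le> 2 / norm (z - 1) / real N" for N
    unfolding norm_divide norm_of_nat by (intro divide_right_mono) auto
  moreover have "(\<lambda>N. 2 / norm (z - 1) / real N) \<longlonglongrightarrow> 0"
    by (rule lim_const_over_n)
  ultimately have "(\<lambda>N. (\<Sum>n = 1..N. z ^ n) / of_nat N) \<longlonglongrightarrow> 0"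
    by (rule Lim_null_comparison[OF always_eventually[OF allI]])
  then show ?thesis
    using False by simp
qed

text \<open>The fraction h/r^s is reduced with respect to s-th powers. After the gcd of
  \<open>r\<close> and \<open>k\<close> is cancelled, coprimality forces \<open>r' ^ s\<close> to
  divide \<open>h\<close>; it also divides \<open>r ^ s\<close>, so \<open>r' = 1\<close>.\<close>

lemma unit_fractions_eq_imp_dvd:
  fixes h j r k :: nat
  assumes "s > 0" "r > 0" "k > 0" "gen_gcd s (int h) (int (r ^ s)) = 1" "h * k ^ s = j * r ^ s"
  shows "r dvd k"
proof -
  define g where "g = gcd r k"
  have g: "g > 0"
    using assms by (simp add: g_def)
  obtain r' k' where rk: "r = r' * g" "k = k' * g" "coprime r' k'"
    using gcd_coprime_exists[of r k] assms unfolding g_def by auto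
  have "h * k' ^ s = j * r' ^ s"
    using assms(5) g by (simp add: rk power_mult_distrib)
  then have "r' ^ s dvd h * k' ^ s"
    by simp
  then have "r' ^ s dvd h"
    using rk(3) by (simp add: coprime_dvd_mult_left_iff)
  moreover have "r' ^ s dvd r ^ s" "r' > 0"
    using assms(2) by (auto simp: rk power_mult_distrib)
  ultimately have "r' = 1"
    using assms gen_gcd_eq_1_iff[of s "r ^ s" h] by simp
  then show ?thesis
    using rk by simp
qed

text \<open>Both fractions lie in the half-open interval (0,1], so their difference is an integer
  only if it is 0.\<close>

lemma cis_fractions_eq_iff:
  fixes h j a b :: nat
  assumes "h \<in> {1..a}" "j \<in> {1..b}"
  shows "cis (2 * pi * real h / real a) * cnj (cis (2 * pi * real j / real b)) = 1 \<longleftrightarrow> h * b = j * a"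
proof -
  have pos: "a > 0" "b > 0"
    using assms by auto
  have bd: "0 < real h / real a" "real h / real a \<le> 1" "0 < real j / real b" "real j / real b \<le> 1"
    using assms by auto
  define x where "x = real h / real a - real j / real b"
  have x: "-1 < x" "x < 1"
    using bd by (auto simp: x_def)
  have "cis (2 * pi * real h / real a) * cnj (cis (2 * pi * real j / real b)) = cis (2 * pi * x)"
    by (simp add: cis_cnj cis_mult x_def algebra_simps)
  also have "cis (2 * pi * x) = 1 \<longleftrightarrow> (\<exists>i::int. x = of_int i)"
    by (subst cis_conv_exp, subst exp_eq_1) (auto simp: algebra_simps)
  also have "\<dots> \<longleftrightarrow> x = 0"
    using x by (auto intro: exI[of _ 0])
  also have "\<dots> \<longleftrightarrow> real h * real b = real j * real a"
    using pos by (simp add: x_def field_simps)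
  also have "\<dots> \<longleftrightarrow> h * b = j * a"
    by (simp flip: of_nat_mult)
  finally show ?thesis .
qed

text \<open>This is the orthogonality relation: averaging keeps exactly the pairs (h, j) whose
  fractions h/r^s and j/k^s coincide.\<close>

lemma tendsto_mean_cohen_ramanujan_sum_mult:
  assumes "s > 0" "r > 0" "k > 0"
  shows "(\<lambda>N. (\<Sum>n = 1..N. cohen_ramanujan_sum s r (int n) * cohen_ramanujan_sum s k (int n)) / of_nat N)
    \<longlonglongrightarrow> (if r = k then of_nat (klee_phi s (r ^ s)) else 0)"
proof -
  define A where "A r = {h \<in> {1..r ^ s}. gen_gcd s (int h) (int (r ^ s)) = 1}" for r
  define z where "z r h = cis (2 * pi * real h / real (r ^ s))" for r h
  define u where "u h j = z r h * cnj (z k j)" for h j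
  have finA [simp]: "finite (A r)" for r
    by (simp add: A_def)
  have c: "cohen_ramanujan_sum s r (int n) = (\<Sum>h\<in>A r. z r h ^ n)" for r n
    unfolding cohen_ramanujan_sum_cis A_def z_def Complex.DeMoivre
    by (intro sum.cong refl arg_cong[of _ _ cis]) (simp add: mult_ac)
  have "cohen_ramanujan_sum s r (int n) * cohen_ramanujan_sum s k (int n) = (\<Sum>h\<in>A r. \<Sum>j\<in>A k. u h j ^ n)" for n
  proof -
    \<comment> \<open>Conjugating the second, real factor makes the exponents differences of
      fractions instead of sums.\<close>
    have "cohen_ramanujan_sum s r (int n) * cohen_ramanujan_sum s k (int n)
        = cohen_ramanujan_sum s r (int n) * cnj (cohen_ramanujan_sum s k (int n))"
      using assms by (simp add: cnj_cohen_ramanujan_sum)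
    also have "\<dots> = (\<Sum>h\<in>A r. \<Sum>j\<in>A k. u h j ^ n)"
      by (simp add: c cnj_sum sum_product u_def power_mult_distrib)
    finally show ?thesis .
  qed
  then have "(\<Sum>n = 1..N. cohen_ramanujan_sum s r (int n) * cohen_ramanujan_sum s k (int n))
      = (\<Sum>h\<in>A r. \<Sum>j\<in>A k. \<Sum>n = 1..N. u h j ^ n)" for N
    by (subst sum.swap, subst sum.swap) simp
  then have mean: "(\<Sum>n = 1..N. cohen_ramanujan_sum s r (int n) * cohen_ramanujan_sum s k (int n)) / of_nat N
      = (\<Sum>h\<in>A r. \<Sum>j\<in>A k. (\<Sum>n = 1..N. u h j ^ n) / of_nat N)" for N
    by (simp add: sum_divide_distrib)
  have "(\<lambda>N. \<Sum>h\<in>A r. \<Sum>j\<in>A k. (\<Sum>n = 1..N. u h j ^ n) / of_nat N)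
      \<longlonglongrightarrow> (\<Sum>h\<in>A r. \<Sum>j\<in>A k. if u h j = 1 then 1 else 0)"
    by (intro tendsto_sum tendsto_mean_powers) (simp add: u_def z_def norm_mult)
  also have "(\<Sum>h\<in>A r. \<Sum>j\<in>A k. if u h j = 1 then 1 else 0 :: complex)
      = (\<Sum>h\<in>A r. \<Sum>j\<in>A k. if r = k \<and> h = j then 1 else 0)"
  proof (intro sum.cong refl)
    fix h j assume hj: "h \<in> A r" "j \<in> A k"
    then have "u h j = 1 \<longleftrightarrow> h * k ^ s = j * r ^ s"
      unfolding u_def z_def by (intro cis_fractions_eq_iff) (auto simp: A_def)
    also have "\<dots> \<longleftrightarrow> r = k \<and> h = j"
    proof
      assume eq: "h * k ^ s = j * r ^ s"
      \<comment> \<open>Both numerators satisfy the gcd condition, so the divisibility argument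
        works in either direction.\<close>
      have "r dvd k" "k dvd r"
        using unit_fractions_eq_imp_dvd[of s r k h j] unit_fractions_eq_imp_dvd[of s k r j h] assms hj eq
        by (auto simp: A_def)
      then have "r = k"
        by (rule dvd_antisym)
      with eq assms show "r = k \<and> h = j"
        by simp
    qed simp
    finally show "(if u h j = 1 then 1 else 0 :: complex) = (if r = k \<and> h = j then 1 else 0)"
      by simp
  qed
  \<comment> \<open>For \<open>r = k\<close> one term is left for each \<open>h\<close> in
    \<open>A r\<close>, the set that \<open>klee_phi\<close> counts.\<close>
  also have "\<dots> = (if r = k then of_nat (klee_phi s (r ^ s)) else 0)"
    by (auto simp: klee_phi_def A_def)
  finally show ?thesis
    by (simp only: mean)
qed

section \<open>Dominated convergence and products of unordered sums\<close>

lemma dominated_convergence_has_sum: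
  fixes a :: "nat \<Rightarrow> 'a \<Rightarrow> 'b :: banach" and M :: "'a \<Rightarrow> real"
  assumes "\<And>N x. x \<in> X \<Longrightarrow> norm (a N x) \<le> M x" "M summable_on X"
    and "\<And>x. x \<in> X \<Longrightarrow> (\<lambda>N. a N x) \<longlonglongrightarrow> b x"
    and "\<And>N. (a N has_sum S N) X" "(b has_sum T) X"
  shows "S \<longlonglongrightarrow> T"
proof (rule swap_uniform_limit')
  \<comment> \<open>The Weierstrass test makes the finite partial sums converge uniformly in
    \<open>N\<close>, which permits exchanging the limit in \<open>N\<close> with the limit over
    finite subsets.\<close>
  show "uniform_limit UNIV (\<lambda>Y N. \<Sum>x\<in>Y. a N x) S (finite_subsets_at_top X)"
    using assms by (intro Weierstrass_m_test_general') auto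
  show "((\<lambda>Y. \<Sum>x\<in>Y. b x) \<longlongrightarrow> T) (finite_subsets_at_top X)"
    using assms(5) by (simp add: has_sum_def)
  show "\<forall>\<^sub>F Y in finite_subsets_at_top X. (\<lambda>N. \<Sum>x\<in>Y. a N x) \<longlonglongrightarrow> (\<Sum>x\<in>Y. b x)"
    using assms(3) by (intro eventually_finite_subsets_at_top_weakI tendsto_sum) auto
qed auto

lemma has_sum_sum:
  fixes f :: "'i \<Rightarrow> 'a \<Rightarrow> 'b :: topological_comm_monoid_add"
  assumes "\<And>i. i \<in> I \<Longrightarrow> (f i has_sum S i) A"
  shows "((\<lambda>x. \<Sum>i\<in>I. f i x) has_sum (\<Sum>i\<in>I. S i)) A"
  using assms by (induction I rule: infinite_finite_induct) (simp_all add: has_sum_add)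

lemma has_sum_product_abs:
  fixes f :: "'a \<Rightarrow> 'c :: {banach, real_normed_algebra}" and g :: "'b \<Rightarrow> 'c"
  assumes "(f has_sum F) A" "(\<lambda>x. norm (f x)) summable_on A"
    and "(g has_sum G) B" "(\<lambda>y. norm (g y)) summable_on B"
  shows "((\<lambda>(x, y). f x * g y) has_sum (F * G)) (A \<times> B)"
proof (rule has_sum_SigmaI)
  show "((\<lambda>y. case (x, y) of (x, y) \<Rightarrow> f x * g y) has_sum f x * G) B" for x
    using assms(3) by (simp add: has_sum_cmult_right)
  show "((\<lambda>x. f x * G) has_sum F * G) A"
    using assms(1) by (rule has_sum_cmult_left)
  \<comment> \<open>Equality of the iterated sum with the sum over pairs requires summability over
    pairs, which comes from the product of the two norm series.\<close>
  have "(\<lambda>(x, y). norm (f x) * norm (g y)) summable_on A \<times> B"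
  proof (rule summable_on_SigmaI)
    show "((\<lambda>y. case (x, y) of (x, y) \<Rightarrow> norm (f x) * norm (g y)) has_sum
        norm (f x) * (\<Sum>\<^sub>\<infinity>y\<in>B. norm (g y))) B" for x
      using assms(4) by (simp add: has_sum_cmult_right)
    show "(\<lambda>x. norm (f x) * (\<Sum>\<^sub>\<infinity>y\<in>B. norm (g y))) summable_on A"
      using assms(2) by (rule summable_on_cmult_left)
  qed auto
  then have "(\<lambda>(x, y). f x * g y) abs_summable_on A \<times> B"
    by (rule Infinite_Sum.abs_summable_on_comparison_test') (auto simp: norm_mult_ineq)
  then show "(\<lambda>(x, y). f x * g y) summable_on A \<times> B"
    by (rule abs_summable_summable)
qed

section \<open>Asymptotics of the mean of f g\<close>

theorem theorem1p1:
  fixes s :: nat and f g fh gh :: "nat \<Rightarrow> complex"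
  assumes "s > 0"
    and "has_abs_cohen_ramanujan_expansion s f fh"
    and "has_abs_cohen_ramanujan_expansion s g gh"
    and "(\<lambda>(r, k). norm (fh r * gh k) * real (gen_gcd s (int (r ^ s)) (int (k ^ s)))
            * real (tau s (r ^ s)) * real (tau s (k ^ s)))
          summable_on ({1..} \<times> {1..})"
  shows "summable (\<lambda>r. fh (Suc r) * gh (Suc r) * of_nat (klee_phi s (Suc r ^ s))) \<and>
    (\<lambda>N::nat. (\<Sum>n = 1..N. f n * g n)
        - of_nat N * (\<Sum>r. fh (Suc r) * gh (Suc r) * of_nat (klee_phi s (Suc r ^ s))))
      \<in> o(\<lambda>N. of_nat N)"
proof -
  define c where "c r n = cohen_ramanujan_sum s r (int n)" for r n
  \<comment> \<open>\<open>M\<close> is the weight of the summability hypothesis with indices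
    shifted to start at 0. It dominates \<open>a N\<close>, the terms of the mean up to
    \<open>N\<close>, whose pointwise limit \<open>b\<close> lives on the diagonal.\<close>
  define M where "M = (\<lambda>(r, k). norm (fh (Suc r) * gh (Suc k)) *
    (real (gcd (Suc r) (Suc k) ^ s) * real (card {d. d dvd Suc r}) * real (card {d. d dvd Suc k})))"
  define a where "a N = (\<lambda>(r, k). fh (Suc r) * gh (Suc k) *
    ((\<Sum>n = 1..N. c (Suc r) n * c (Suc k) n) / of_nat N))" for N
  define t where "t r = fh (Suc r) * gh (Suc r) * of_nat (klee_phi s (Suc r ^ s))" for r
  define b where "b = (\<lambda>(r, k). if r = k then t r else 0)"

  have M: "M summable_on UNIV"
  proof -
    have "(\<lambda>(r, k). norm (fh r * gh k) * real (gen_gcd s (int (r ^ s)) (int (k ^ s)))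
            * real (tau s (r ^ s)) * real (tau s (k ^ s))) summable_on ({1..} \<times> {1..}) \<longleftrightarrow> M summable_on UNIV"
      using assms(1)
      by (intro summable_on_reindex_bij_witness[of _ "\<lambda>(r, k). (Suc r, Suc k)" "\<lambda>(r, k). (r - 1, k - 1)"])
         (auto simp: M_def tau_power gen_gcd_power_power simp del: of_nat_power)
    with assms(4) show ?thesis
      by simp
  qed
  have a_le: "norm (a N x) \<le> M x" for N x
  proof -
    obtain r k where x: "x = (r, k)"
      by force
    have "norm ((\<Sum>n = 1..N. c (Suc r) n * c (Suc k) n) / of_nat N)
        \<le> (\<Sum>n = 1..N. norm (c (Suc r) n * c (Suc k) n)) / real N"
      by (simp add: norm_divide divide_right_mono norm_sum)
    also have "\<dots> \<le> real (gcd (Suc r) (Suc k) ^ s) * real (card {d. d dvd Suc r}) * real (card {d. d dvd Suc k})"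
    \<comment> \<open>At \<open>N = 0\<close> the quotient is 0 and the bound is
      nonnegative.\<close>
    proof (cases "N = 0")
      case False
      then show ?thesis
        using sum_norm_cohen_ramanujan_sum_le[of s "Suc r" "Suc k" N] assms(1)
        by (simp add: c_def divide_le_eq mult.commute)
    qed simp
    finally show ?thesis
      unfolding x a_def M_def prod.case norm_mult[of "_ * _" "_ / _"] by (rule mult_left_mono) simp
  qed
  have a_lim: "(\<lambda>N. a N x) \<longlonglongrightarrow> b x" for x
  proof -
    obtain r k where x: "x = (r, k)"
      by force
    show ?thesis
      using tendsto_mult[OF tendsto_const tendsto_mean_cohen_ramanujan_sum_mult[of s "Suc r" "Suc k"],
          of "fh (Suc r) * gh (Suc k)"] assms(1)
      by (simp add: x a_def b_def t_def c_def if_distrib cong: if_cong split: if_splits)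
  qed
  \<comment> \<open>For each positive \<open>n\<close> the two absolutely convergent expansions
    multiply to a sum over all pairs; finitely many such sums are then added and divided by
    \<open>N\<close>.\<close>
  have a_sum: "(a N has_sum (\<Sum>n = 1..N. f n * g n) / of_nat N) UNIV" for N
  proof -
    have "((\<lambda>(r, k). (fh (Suc r) * c (Suc r) n) * (gh (Suc k) * c (Suc k) n)) has_sum f n * g n) (UNIV \<times> UNIV)"
      if "n \<in> {1..N}" for n
      using that assms(2,3) unfolding has_abs_cohen_ramanujan_expansion_def c_def
      by (intro has_sum_product_abs norm_summable_imp_has_sum norm_summable_imp_summable_on) auto
    then have "((\<lambda>x. \<Sum>n = 1..N. case x of (r, k) \<Rightarrow>
        (fh (Suc r) * c (Suc r) n) * (gh (Suc k) * c (Suc k) n)) has_sum (\<Sum>n = 1..N. f n * g n)) UNIV"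
      by (intro has_sum_sum) auto
    then have "((\<lambda>x. (\<Sum>n = 1..N. case x of (r, k) \<Rightarrow>
        (fh (Suc r) * c (Suc r) n) * (gh (Suc k) * c (Suc k) n)) / of_nat N)
        has_sum (\<Sum>n = 1..N. f n * g n) / of_nat N) UNIV"
      by (rule has_sum_divide_const)
    then show ?thesis
      by (rule has_sum_cong[THEN iffD1, rotated])
         (auto simp: a_def sum_distrib_left sum_divide_distrib mult_ac)
  qed

  \<comment> \<open>The bound passes to the limit. Restricted to the diagonal, it gives absolute
    convergence of the series on the right-hand side.\<close>
  have b_le: "norm (b x) \<le> M x" for x
    using a_le by (intro Lim_bounded[OF tendsto_norm[OF a_lim]]) auto
  have b_summable: "(\<lambda>x. norm (b x)) summable_on UNIV"
    by (rule Infinite_Sum.abs_summable_on_comparison_test'[OF M b_le])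
  then have "(\<lambda>x. norm (b x)) summable_on range (\<lambda>r. (r, r))"
    by (rule summable_on_subset_banach) simp
  then have "(\<lambda>r. norm (t r)) summable_on UNIV"
    by (subst (asm) summable_on_reindex) (auto simp: inj_on_def b_def o_def)
  then have t_summable: "summable (\<lambda>r. norm (t r))"
    by (rule summable_on_imp_summable)
  then have "(t has_sum suminf t) UNIV"
    using summable_norm_cancel by (intro norm_summable_imp_has_sum summable_sums) auto
  then have "(b has_sum suminf t) (range (\<lambda>r. (r, r)))"
    by (subst has_sum_reindex) (auto simp: inj_on_def b_def o_def)
  \<comment> \<open>Off the diagonal \<open>b\<close> vanishes, so extending the sum to all pairs
    changes nothing.\<close>
  then have b_sum: "(b has_sum suminf t) UNIV"
    by (rule has_sum_cong_neutral[THEN iffD1, rotated -1]) (auto simp: b_def)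

  have lim: "(\<lambda>N. (\<Sum>n = 1..N. f n * g n) / of_nat N) \<longlonglongrightarrow> suminf t"
    by (rule dominated_convergence_has_sum[OF a_le M a_lim a_sum b_sum])
  have "(\<lambda>N. ((\<Sum>n = 1..N. f n * g n) - of_nat N * suminf t) / of_nat N) \<longlonglongrightarrow> 0"
  proof (rule Lim_transform_eventually)
    show "(\<lambda>N. (\<Sum>n = 1..N. f n * g n) / of_nat N - suminf t) \<longlonglongrightarrow> 0"
      using lim by (simp add: LIM_zero)
    show "\<forall>\<^sub>F N in sequentially. (\<Sum>n = 1..N. f n * g n) / of_nat N - suminf t
        = ((\<Sum>n = 1..N. f n * g n) - of_nat N * suminf t) / of_nat N"
      using eventually_gt_at_top[of 0] by eventually_elim (simp add: field_simps)
  qed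
  then have "(\<lambda>N. (\<Sum>n = 1..N. f n * g n) - of_nat N * suminf t) \<in> o(\<lambda>N. of_nat N)"
    by (rule smalloI_tendsto) (use eventually_gt_at_top[of 0] in eventually_elim, simp)
  with t_summable show ?thesis
    unfolding t_def by (blast intro: summable_norm_cancel)
qed

end
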